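(* Let $R$ be a hemiring. The following assertions are equivalent: (1) Each $h$-ideal $A$ of $R$ is $h$-idempotent, i.e. $\overline{AA}=A$. (2) Each proper $h$-ideal $P$ of $R$ is the intersection of all prime $h$-ideals of $R$ containing $P$.
   Context: A hemiring is a set $R$ with operations $+$ and $\cdot$ such that $(R,+)$ is a commutative semigroup, $(R,\cdot)$ is a semigroup, multiplication distributes over addition on both sides, and there is $0\in R$ with $a+0=0+a=a$ and $a0=0a=0$ for all $a\in R$. An $h$-ideal of $R$ is a non-empty subset $I$ closed under addition, with $ra,ar\in I$ for all $a\in I$, $r\in R$, and such that $x+a+y=b+y$ with $a,b\in I$, $x,y\in R$ implies $x\in I$. For subsets $A,B$, $AB$ is the set of finite sums of products $ab$ with $a\in A$, $b\in B$. The $h$-closure of a non-empty $A\subseteq R$ is $\overline{A}=\{x\in R\mid x+a+y=b+y\text{ for some }a,b\in A,\ y\in R\}$. An $h$-ideal $P$ is prime if $P\neq R$ and for any $h$-ideals $A,B$ of $R$, $AB\subseteq P$ implies $A\subseteq P$ or $B\subseteq P$. *)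

theory Defs
  imports Main
begin

text \<open>
  The class \<^class>\<open>semiring_0\<close> has exactly the axioms of a hemiring: no multiplicative unit,
  no commutativity of multiplication and no additive cancellation is assumed. The hemiring
  \<open>R\<close> is the whole type, so \<open>R\<close> as a set is \<^term>\<open>UNIV\<close>.
\<close>

definition h_ideal :: "'a::semiring_0 set \<Rightarrow> bool" where
  "h_ideal I \<longleftrightarrow>
     I \<noteq> {} \<and>
     (\<forall>a\<in>I. \<forall>b\<in>I. a + b \<in> I) \<and>
     (\<forall>a\<in>I. \<forall>r. r * a \<in> I \<and> a * r \<in> I) \<and>
     (\<forall>x y. \<forall>a\<in>I. \<forall>b\<in>I. x + a + y = b + y \<longrightarrow> x \<in> I)"

text \<open>
  The empty sum is allowed. This matters only when \<open>A\<close> and \<open>B\<close> do not already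
  yield \<open>0\<close>; for \<open>h\<close>-ideals, which contain \<open>0\<close>, it adds nothing.
\<close>

definition set_product :: "'a::semiring_0 set \<Rightarrow> 'a set \<Rightarrow> 'a set" where
  "set_product A B =
     {(\<Sum>i<n. a i * b i) | (n::nat) a b. \<forall>i<n. a i \<in> A \<and> b i \<in> B}"

definition h_closure :: "'a::semiring_0 set \<Rightarrow> 'a set" where
  "h_closure A = {x. \<exists>a\<in>A. \<exists>b\<in>A. \<exists>y. x + a + y = b + y}"

definition h_idempotent :: "'a::semiring_0 set \<Rightarrow> bool" where
  "h_idempotent A \<longleftrightarrow> h_closure (set_product A A) = A"

definition prime_h_ideal :: "'a::semiring_0 set \<Rightarrow> bool" where
  "prime_h_ideal P \<longleftrightarrow>
     h_ideal P \<and> P \<noteq> UNIV \<and>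
     (\<forall>A B. h_ideal A \<longrightarrow> h_ideal B \<longrightarrow> set_product A B \<subseteq> P \<longrightarrow> A \<subseteq> P \<or> B \<subseteq> P)"

end

(* The h-ideals Q with x \<notin> Q have maximal members by Zorn's lemma. If all h-ideals are h-idempotent,
   such a maximal Q is prime: for AB \<subseteq> Q, the residual L = {a. aB \<subseteq> Q} is an h-ideal containing
   A and Q, and M = {b. Lb \<subseteq> Q} is an h-ideal containing B and Q. If neither A nor B lay in Q, then
   x \<in> L \<inter> M by maximality, and x would lie in the h-closure of (L \<inter> M)(L \<inter> M), hence in Q.
   Conversely, the h-closure of AA is an h-ideal, and every prime h-ideal containing AA contains A. *)

theory Submission
  imports Defs
begin

section \<open>Elementary closure properties of h-ideals, their intersections and unions of
  chains\<close>

lemma h_idealI: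
  assumes "0 \<in> I"
    and "\<And>a b. a \<in> I \<Longrightarrow> b \<in> I \<Longrightarrow> a + b \<in> I"
    and "\<And>a r. a \<in> I \<Longrightarrow> r * a \<in> I"
    and "\<And>a r. a \<in> I \<Longrightarrow> a * r \<in> I"
    and "\<And>x y a b. a \<in> I \<Longrightarrow> b \<in> I \<Longrightarrow> x + a + y = b + y \<Longrightarrow> x \<in> I"
  shows "h_ideal I"
  using assms unfolding h_ideal_def by blast

lemma h_ideal_zero:
  assumes "h_ideal I"
  shows "0 \<in> I"
proof -
  obtain a where "a \<in> I"
    using assms unfolding h_ideal_def by blast
  then have "0 * a \<in> I"
    using assms unfolding h_ideal_def by blast
  then show ?thesis by simp
qed

lemma h_ideal_add: "h_ideal I \<Longrightarrow> a \<in> I \<Longrightarrow> b \<in> I \<Longrightarrow> a + b \<in> I"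
  and h_ideal_mult_left: "h_ideal I \<Longrightarrow> a \<in> I \<Longrightarrow> r * a \<in> I"
  and h_ideal_mult_right: "h_ideal I \<Longrightarrow> a \<in> I \<Longrightarrow> a * r \<in> I"
  unfolding h_ideal_def by blast+

lemma h_ideal_closed:
  "h_ideal I \<Longrightarrow> a \<in> I \<Longrightarrow> b \<in> I \<Longrightarrow> x + a + y = b + y \<Longrightarrow> x \<in> I"
  unfolding h_ideal_def by blast

lemma h_ideal_Int:
  assumes "h_ideal I" "h_ideal J"
  shows "h_ideal (I \<inter> J)"
  by (rule h_idealI)
    (use assms in \<open>auto intro: h_ideal_zero h_ideal_add h_ideal_mult_left h_ideal_mult_right
      h_ideal_closed\<close>)

text \<open>Each closure condition involves at most two elements of the union, and these lie in a
  common member of the chain. Non-emptiness of \<open>C\<close> supplies \<open>0\<close>.\<close>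

lemma h_ideal_Union_chain:
  assumes "C \<noteq> {}" and chain: "subset.chain {I. h_ideal I} C"
  shows "h_ideal (\<Union>C)"
proof -
  have ideal: "h_ideal I" if "I \<in> C" for I
    using chain that unfolding subset.chain_def by blast
  have common: "\<exists>I\<in>C. a \<in> I \<and> b \<in> I" if ab: "a \<in> \<Union>C" "b \<in> \<Union>C" for a b
  proof -
    obtain I J where IJ: "I \<in> C" "a \<in> I" "J \<in> C" "b \<in> J"
      using ab by blast
    then have "I \<subseteq> J \<or> J \<subseteq> I"
      using chain by (auto simp: subset_chain_def)
    then show ?thesis
      using IJ by blast
  qed
  show ?thesis
  proof (rule h_idealI)
    show "0 \<in> \<Union>C"
      using assms(1) ideal h_ideal_zero by blast
    show "a + b \<in> \<Union>C" if "a \<in> \<Union>C" "b \<in> \<Union>C" for a b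
      using common[OF that] ideal h_ideal_add by blast
    show "r * a \<in> \<Union>C" if "a \<in> \<Union>C" for a r
      using that ideal h_ideal_mult_left by blast
    show "a * r \<in> \<Union>C" if "a \<in> \<Union>C" for a r
      using that ideal h_ideal_mult_right by blast
    show "x \<in> \<Union>C" if "a \<in> \<Union>C" "b \<in> \<Union>C" "x + a + y = b + y" for x y a b
      using common[OF that(1,2)] that(3) ideal h_ideal_closed by blast
  qed
qed

section \<open>Finite sums of products\<close>

lemma sum_in_set_product:
  fixes n :: nat
  assumes "\<And>i. i < n \<Longrightarrow> a i \<in> A" "\<And>i. i < n \<Longrightarrow> b i \<in> B"
  shows "(\<Sum>i<n. a i * b i) \<in> set_product A B"
  using assms unfolding set_product_def by blast

text \<open>An h-ideal contains \<open>0\<close> and is closed under addition, so induction on the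
  number of summands reduces the inclusion to single products. This removes finite sums from the
  later arguments with residuals.\<close>

lemma set_product_subset_iff:
  assumes "h_ideal P"
  shows "set_product A B \<subseteq> P \<longleftrightarrow> (\<forall>a\<in>A. \<forall>b\<in>B. a * b \<in> P)"
proof
  assume sub: "set_product A B \<subseteq> P"
  show "\<forall>a\<in>A. \<forall>b\<in>B. a * b \<in> P"
  proof (intro ballI)
    fix a b assume "a \<in> A" "b \<in> B"
    then have "(\<Sum>i<Suc 0. a * b) \<in> set_product A B"
      by (intro sum_in_set_product)
    then show "a * b \<in> P"
      using sub by auto
  qed
next
  assume prods: "\<forall>a\<in>A. \<forall>b\<in>B. a * b \<in> P"
  have "(\<Sum>i<n. a i * b i) \<in> P" if "\<forall>i<n. a i \<in> A \<and> b i \<in> B" for n :: nat and a b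
    using that by (induction n) (simp_all add: prods h_ideal_zero h_ideal_add assms)
  then show "set_product A B \<subseteq> P"
    unfolding set_product_def by blast
qed

lemma set_product_zero: "0 \<in> set_product A B"
  unfolding set_product_def by (auto intro: exI[of _ "0::nat"])

text \<open>This is the induction step for adding two finite sums: the second sum is appended term
  by term.\<close>

lemma set_product_add_mult:
  assumes "s \<in> set_product A B" "a \<in> A" "b \<in> B"
  shows "s + a * b \<in> set_product A B"
proof -
  obtain n :: nat and f g where s: "s = (\<Sum>i<n. f i * g i)" and fg: "\<forall>i<n. f i \<in> A \<and> g i \<in> B"
    using assms(1) unfolding set_product_def by blast
  \<comment> \<open>The new product takes index \<open>n\<close>, which the old sum does not use, so
    the update leaves the earlier terms unchanged.\<close>
  have "s + a * b = (\<Sum>i<Suc n. (f(n := a)) i * (g(n := b)) i)"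
    by (simp add: s)
  moreover have "\<forall>i<Suc n. (f(n := a)) i \<in> A \<and> (g(n := b)) i \<in> B"
    using fg assms(2,3) by (simp add: less_Suc_eq)
  ultimately show ?thesis
    unfolding set_product_def by blast
qed

lemma set_product_add:
  assumes s: "s \<in> set_product A B" and t: "t \<in> set_product A B"
  shows "s + t \<in> set_product A B"
proof -
  have "s + (\<Sum>i<n. a i * b i) \<in> set_product A B"
    if "\<forall>i<n. a i \<in> A \<and> b i \<in> B" for n :: nat and a b
    using that
    by (induction n) (simp_all add: s set_product_add_mult flip: add.assoc)
  then show ?thesis
    using t unfolding set_product_def by blast
qed

text \<open>The multiplier is absorbed by the left factor of each summand, so only \<open>A\<close>
  has to be an ideal; on the other side the same holds for \<open>B\<close>.\<close>

lemma set_product_mult_left: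
  assumes "h_ideal A" "s \<in> set_product A B"
  shows "r * s \<in> set_product A B"
proof -
  obtain n :: nat and f g where s: "s = (\<Sum>i<n. f i * g i)" and fg: "\<forall>i<n. f i \<in> A \<and> g i \<in> B"
    using assms(2) unfolding set_product_def by blast
  have "r * s = (\<Sum>i<n. r * f i * g i)"
    by (simp add: s sum_distrib_left mult.assoc)
  also have "\<dots> \<in> set_product A B"
    by (intro sum_in_set_product) (use fg h_ideal_mult_left[OF assms(1)] in auto)
  finally show ?thesis .
qed

lemma set_product_mult_right:
  assumes "h_ideal B" "s \<in> set_product A B"
  shows "s * r \<in> set_product A B"
proof -
  obtain n :: nat and f g where s: "s = (\<Sum>i<n. f i * g i)" and fg: "\<forall>i<n. f i \<in> A \<and> g i \<in> B"
    using assms(2) unfolding set_product_def by blast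
  have "s * r = (\<Sum>i<n. f i * (g i * r))"
    by (simp add: s sum_distrib_right mult.assoc)
  also have "\<dots> \<in> set_product A B"
    by (intro sum_in_set_product) (use fg h_ideal_mult_right[OF assms(1)] in auto)
  finally show ?thesis .
qed

section \<open>The h-closure as an h-ideal\<close>

lemma h_closure_least: "h_ideal I \<Longrightarrow> S \<subseteq> I \<Longrightarrow> h_closure S \<subseteq> I"
  unfolding h_closure_def by (blast intro: h_ideal_closed)

lemma h_closure_superset:
  assumes "0 \<in> S"
  shows "S \<subseteq> h_closure S"
proof
  fix x assume "x \<in> S"
  \<comment> \<open>The witnesses are \<open>a = 0\<close>, \<open>b = x\<close> and
    \<open>y = 0\<close>.\<close>
  moreover have "x + 0 + 0 = x + 0"
    by simp
  ultimately show "x \<in> h_closure S"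
    unfolding h_closure_def using assms by blast
qed

lemma h_closureI: "a \<in> S \<Longrightarrow> b \<in> S \<Longrightarrow> x + a + y = b + y \<Longrightarrow> x \<in> h_closure S"
  unfolding h_closure_def by blast

lemma h_closureE:
  assumes "x \<in> h_closure S"
  obtains a b y where "a \<in> S" "b \<in> S" "x + a + y = b + y"
  using assms unfolding h_closure_def by blast

lemma h_ideal_h_closure:
  assumes zero: "0 \<in> S"
    and add: "\<And>a b. a \<in> S \<Longrightarrow> b \<in> S \<Longrightarrow> a + b \<in> S"
    and left: "\<And>a r. a \<in> S \<Longrightarrow> r * a \<in> S"
    and right: "\<And>a r. a \<in> S \<Longrightarrow> a * r \<in> S"
  shows "h_ideal (h_closure S)"
proof (rule h_idealI)
  show "0 \<in> h_closure S"
    using h_closure_superset zero by blast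
next
  fix u v assume "u \<in> h_closure S" "v \<in> h_closure S"
  then obtain a b y c d z where S: "a \<in> S" "b \<in> S" "c \<in> S" "d \<in> S"
    and eq: "u + a + y = b + y" "v + c + z = d + z"
    by (metis h_closureE)
  have "(u + v) + (a + c) + (y + z) = (u + a + y) + (v + c + z)"
    by (simp add: ac_simps)
  also have "\<dots> = (b + d) + (y + z)"
    unfolding eq by (simp add: ac_simps)
  finally show "u + v \<in> h_closure S"
    using S by (blast intro: h_closureI add)
next
  fix u r assume "u \<in> h_closure S"
  then obtain a b y where S: "a \<in> S" "b \<in> S" and eq: "u + a + y = b + y"
    by (rule h_closureE)
  from arg_cong[OF eq, of "\<lambda>t. r * t"] have "r * u + r * a + r * y = r * b + r * y"
    by (simp add: distrib_left)
  with S show "r * u \<in> h_closure S"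
    by (blast intro: h_closureI left)
  from arg_cong[OF eq, of "\<lambda>t. t * r"] have "u * r + a * r + y * r = b * r + y * r"
    by (simp add: distrib_right)
  with S show "u * r \<in> h_closure S"
    by (blast intro: h_closureI right)
next
  fix x y u v assume "u \<in> h_closure S" "v \<in> h_closure S" and x: "x + u + y = v + y"
  then obtain a b z c d w where S: "a \<in> S" "b \<in> S" "c \<in> S" "d \<in> S"
    and eq: "u + a + z = b + z" "v + c + w = d + w"
    by (metis h_closureE)
  \<comment> \<open>Without subtraction, \<open>u\<close> and \<open>v\<close> are eliminated by
    substitution: \<open>b + z\<close> is expanded to \<open>u + a + z\<close> so that the equation
    for \<open>x\<close> applies, and then \<open>v + c + w\<close> collapses to
    \<open>d + w\<close>. The witnesses in \<open>S\<close> are \<open>b + c\<close> and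
    \<open>d + a\<close>, with \<open>y + z + w\<close> on both sides.\<close>
  have "x + (b + c) + (y + z + w) = x + (b + z) + (y + c + w)"
    by (simp add: ac_simps)
  also have "\<dots> = (x + u + y) + (a + z + c + w)"
    unfolding eq(1)[symmetric] by (simp add: ac_simps)
  also have "\<dots> = (v + c + w) + (y + a + z)"
    unfolding x by (simp add: ac_simps)
  also have "\<dots> = (d + a) + (y + z + w)"
    unfolding eq by (simp add: ac_simps)
  finally show "x \<in> h_closure S"
    using S by (blast intro: h_closureI add)
qed

lemma h_ideal_h_closure_set_product:
  assumes "h_ideal A" "h_ideal B"
  shows "h_ideal (h_closure (set_product A B))"
  by (intro h_ideal_h_closure set_product_zero set_product_add
      set_product_mult_left[OF assms(1)] set_product_mult_right[OF assms(2)])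

section \<open>Residuals of h-ideals\<close>

text \<open>Multiplying \<open>x + u + y = v + y\<close> by \<open>b\<close> gives an equation of
  the same shape, to which h-closedness of \<open>Q\<close> applies. Right absorption uses that
  \<open>r * b\<close> stays in \<open>B\<close>.\<close>

lemma h_ideal_left_residual:
  assumes Q: "h_ideal Q" and B: "h_ideal B"
  shows "h_ideal {a. \<forall>b\<in>B. a * b \<in> Q}"
proof (rule h_idealI)
  fix x y u v
  assume uv: "u \<in> {a. \<forall>b\<in>B. a * b \<in> Q}" "v \<in> {a. \<forall>b\<in>B. a * b \<in> Q}"
    and eq: "x + u + y = v + y"
  have "x * b \<in> Q" if "b \<in> B" for b
  proof (rule h_ideal_closed[OF Q])
    show "u * b \<in> Q" "v * b \<in> Q"
      using uv that by auto
    show "x * b + u * b + y * b = v * b + y * b"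
      using arg_cong[OF eq, of "\<lambda>t. t * b"] by (simp add: distrib_right)
  qed
  then show "x \<in> {a. \<forall>b\<in>B. a * b \<in> Q}"
    by blast
qed (auto simp: distrib_right mult.assoc
    intro: h_ideal_zero[OF Q] h_ideal_add[OF Q] h_ideal_mult_left[OF Q] h_ideal_mult_left[OF B])

lemma h_ideal_right_residual:
  assumes Q: "h_ideal Q" and A: "h_ideal A"
  shows "h_ideal {b. \<forall>a\<in>A. a * b \<in> Q}"
proof (rule h_idealI)
  fix x y u v
  assume uv: "u \<in> {b. \<forall>a\<in>A. a * b \<in> Q}" "v \<in> {b. \<forall>a\<in>A. a * b \<in> Q}"
    and eq: "x + u + y = v + y"
  have "a * x \<in> Q" if "a \<in> A" for a
  proof (rule h_ideal_closed[OF Q])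
    show "a * u \<in> Q" "a * v \<in> Q"
      using uv that by auto
    show "a * x + a * u + a * y = a * v + a * y"
      using arg_cong[OF eq, of "\<lambda>t. a * t"] by (simp add: distrib_left)
  qed
  then show "x \<in> {b. \<forall>a\<in>A. a * b \<in> Q}"
    by blast
next
  fix b r assume "b \<in> {b. \<forall>a\<in>A. a * b \<in> Q}"
  then have "a * r * b \<in> Q" if "a \<in> A" for a
    using that h_ideal_mult_right[OF A] by blast
  then show "r * b \<in> {b. \<forall>a\<in>A. a * b \<in> Q}"
    by (simp add: mult.assoc)
next
  fix b r assume "b \<in> {b. \<forall>a\<in>A. a * b \<in> Q}"
  then have "a * b * r \<in> Q" if "a \<in> A" for a
    using that h_ideal_mult_right[OF Q] by blast
  then show "b * r \<in> {b. \<forall>a\<in>A. a * b \<in> Q}"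
    by (simp add: mult.assoc)
qed (auto simp: distrib_left intro: h_ideal_zero[OF Q] h_ideal_add[OF Q])

section \<open>Maximal h-ideals avoiding an element, and their primeness\<close>

text \<open>Zorn's lemma is applied to the h-ideals that contain \<open>P\<close> and avoid
  \<open>x\<close>. The maximality clause need not mention \<open>P\<close>, since
  \<open>Q \<subseteq> I\<close> already forces \<open>P \<subseteq> I\<close>.\<close>

lemma exists_maximal_h_ideal_avoiding:
  assumes "h_ideal P" "x \<notin> P"
  obtains Q where "h_ideal Q" "P \<subseteq> Q" "x \<notin> Q"
    "\<And>I. h_ideal I \<Longrightarrow> Q \<subseteq> I \<Longrightarrow> x \<notin> I \<Longrightarrow> I = Q"
proof -
  let ?F = "{I. h_ideal I \<and> P \<subseteq> I \<and> x \<notin> I}"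
  have "\<exists>Q\<in>?F. \<forall>I\<in>?F. Q \<subseteq> I \<longrightarrow> I = Q"
  proof (rule subset_Zorn_nonempty)
    show "?F \<noteq> {}"
      using assms by blast
    fix C assume C: "C \<noteq> {}" "subset.chain ?F C"
    then have "subset.chain {I. h_ideal I} C"
      by (auto simp: subset_chain_def)
    then have "h_ideal (\<Union>C)"
      using C(1) by (rule h_ideal_Union_chain[rotated])
    moreover have "P \<subseteq> \<Union>C" "x \<notin> \<Union>C"
      using C unfolding subset_chain_def by blast+
    ultimately show "\<Union>C \<in> ?F"
      by simp
  qed
  then obtain Q where "Q \<in> ?F" "\<forall>I\<in>?F. Q \<subseteq> I \<longrightarrow> I = Q"
    by blast
  then show ?thesis
    by (intro that[of Q]) auto
qed

lemma maximal_avoiding_imp_prime: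
  assumes idem: "\<And>A :: 'a::semiring_0 set. h_ideal A \<Longrightarrow> h_idempotent A"
    and Q: "h_ideal (Q :: 'a set)" and x: "x \<notin> Q"
    and max: "\<And>I. h_ideal I \<Longrightarrow> Q \<subseteq> I \<Longrightarrow> x \<notin> I \<Longrightarrow> I = Q"
  shows "prime_h_ideal Q"
  unfolding prime_h_ideal_def
proof (intro conjI allI impI)
  show "h_ideal Q" "Q \<noteq> UNIV"
    using Q x by auto
  fix A B :: "'a set"
  assume A: "h_ideal A" and B: "h_ideal B" and "set_product A B \<subseteq> Q"
  then have AB: "a * b \<in> Q" if "a \<in> A" "b \<in> B" for a b
    using that set_product_subset_iff[OF Q] by blast
  define L where "L = {a. \<forall>b\<in>B. a * b \<in> Q}"
  \<comment> \<open>Taking the residual by \<open>L\<close> instead of \<open>A\<close> gives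
    \<open>a * b \<in> Q\<close> for all \<open>a \<in> L\<close> and \<open>b \<in> M\<close>, and
    still \<open>B \<subseteq> M\<close> by the choice of \<open>L\<close>.\<close>
  define M where "M = {b. \<forall>a\<in>L. a * b \<in> Q}"
  have L: "h_ideal L"
    unfolding L_def by (rule h_ideal_left_residual[OF Q B])
  have M: "h_ideal M"
    unfolding M_def by (rule h_ideal_right_residual[OF Q L])
  have "A \<subseteq> L" "Q \<subseteq> L" "B \<subseteq> M" "Q \<subseteq> M"
    unfolding M_def L_def by (auto intro: AB h_ideal_mult_right[OF Q] h_ideal_mult_left[OF Q])
  show "A \<subseteq> Q \<or> B \<subseteq> Q"
  proof (rule ccontr)
    assume "\<not> (A \<subseteq> Q \<or> B \<subseteq> Q)"
    then have "x \<in> L \<inter> M"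
      \<comment> \<open>If \<open>x\<close> were not in \<open>L\<close>, maximality would give
        \<open>L = Q\<close> and hence \<open>A \<subseteq> Q\<close>; likewise for \<open>M\<close>
        and \<open>B\<close>.\<close>
      using max[OF L \<open>Q \<subseteq> L\<close>] max[OF M \<open>Q \<subseteq> M\<close>] \<open>A \<subseteq> L\<close> \<open>B \<subseteq> M\<close> by blast
    also have "L \<inter> M = h_closure (set_product (L \<inter> M) (L \<inter> M))"
      using idem[OF h_ideal_Int[OF L M]] unfolding h_idempotent_def by simp
    also have "\<dots> \<subseteq> Q"
      \<comment> \<open>In each product the left factor is used as a member of \<open>L\<close> and
        the right one as a member of \<open>M\<close>.\<close>
      by (intro h_closure_least Q) (auto simp: set_product_subset_iff[OF Q] M_def)
    finally show False
      using x by contradiction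
  qed
qed

theorem theorem5p13:
  shows "(\<forall>A :: 'a::semiring_0 set. h_ideal A \<longrightarrow> h_idempotent A) \<longleftrightarrow>
         (\<forall>P :: 'a set. h_ideal P \<and> P \<noteq> UNIV \<longrightarrow>
            P = \<Inter> {Q. prime_h_ideal Q \<and> P \<subseteq> Q})"
proof (intro iffI allI impI)
  fix P :: "'a set"
  assume idem: "\<forall>A :: 'a set. h_ideal A \<longrightarrow> h_idempotent A" and P: "h_ideal P \<and> P \<noteq> UNIV"
  have "\<exists>Q. prime_h_ideal Q \<and> P \<subseteq> Q \<and> x \<notin> Q" if "x \<notin> P" for x
    using P that idem by (metis exists_maximal_h_ideal_avoiding maximal_avoiding_imp_prime)
  then show "P = \<Inter> {Q. prime_h_ideal Q \<and> P \<subseteq> Q}"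
    by blast
next
  fix A :: "'a set"
  assume inter: "\<forall>P :: 'a set. h_ideal P \<and> P \<noteq> UNIV \<longrightarrow>
      P = \<Inter> {Q. prime_h_ideal Q \<and> P \<subseteq> Q}"
    and A: "h_ideal A"
  let ?D = "h_closure (set_product A A)"
  have D: "h_ideal ?D"
    by (rule h_ideal_h_closure_set_product[OF A A])
  have "?D \<subseteq> A"
    by (intro h_closure_least A) (simp add: set_product_subset_iff[OF A] h_ideal_mult_left[OF A])
  moreover have "A \<subseteq> ?D"
  \<comment> \<open>The hypothesis covers only proper h-ideals; if \<open>?D\<close> is everything,
    the inclusion is immediate.\<close>
  proof (cases "?D = UNIV")
    case False
    have "A \<subseteq> Q" if "prime_h_ideal Q" "?D \<subseteq> Q" for Q
    proof -
      have "set_product A A \<subseteq> Q"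
        using h_closure_superset[OF set_product_zero] that(2) by blast
      \<comment> \<open>Primeness is applied with \<open>A\<close> as both factors, so both
        alternatives say \<open>A \<subseteq> Q\<close>.\<close>
      then show ?thesis
        using that(1) A unfolding prime_h_ideal_def by blast
    qed
    then have "A \<subseteq> \<Inter> {Q. prime_h_ideal Q \<and> ?D \<subseteq> Q}"
      by blast
    also have "\<dots> = ?D"
      using inter D False by blast
    finally show ?thesis .
  qed simp
  ultimately show "h_idempotent A"
    unfolding h_idempotent_def by blast
qed

end
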